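(* Let $1\leq p<\infty$ and let $I$ be an infinite index set. For a family $(X_i)_{i\in I}$ of Banach spaces put $X_J:=\bigl[\bigoplus_{i\in J}X_i\bigr]_p$ for every finite $J\subseteq I$. Suppose that $$\omega(\varepsilon,R):=\inf\{\eta_{X_J}(\varepsilon,R): J\subseteq I\text{ finite}\}>0\quad\text{for all }\varepsilon,R>0.$$ Then $X:=\bigl[\bigoplus_{i\in I}X_i\bigr]_p$ has the uniform Opial property.
   Context: All Banach spaces are real. The $\ell^p$-sum $\bigl[\bigoplus_{i\in I}X_i\bigr]_p$ is the Banach space of all $(x_i)_{i\in I}\in\prod_{i\in I}X_i$ with $(\|x_i\|)_{i\in I}\in\ell^p(I)$, with norm $\|(x_i)_{i\in I}\|_p:=\bigl(\sum_{i\in I}\|x_i\|^p\bigr)^{1/p}$. For a Banach space $X$ and $\varepsilon,R>0$ put $$\eta_X(\varepsilon,R):=\inf\Bigl\{\liminf_{n\to\infty}\|x_n-x\|-\liminf_{n\to\infty}\|x_n\|\Bigr\},$$ where the infimum is taken over all $x\in X$ with $\|x\|\geq\varepsilon$ and all weakly null sequences $(x_n)_{n\in\mathbb{N}}$ in $X$ with $\limsup_{n\to\infty}\|x_n\|\leq R$. A Banach space $X$ has the uniform Opial property if for every $c>0$ there is some $r>0$ such that $1+r\leq\liminf_{n\to\infty}\|x_n-x\|$ for every $x\in X$ with $\|x\|\geq c$ and every weakly null sequence $(x_n)_{n\in\mathbb{N}}$ in $X$ with $\liminf_{n\to\infty}\|x_n\|\geq 1$. Equivalently, $\eta_X(\varepsilon,R)>0$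 for all $\varepsilon,R>0$. *)

theory Defs
  imports
    "HOL-Analysis.Analysis"
    "HOL-Algebra.Module"
    "HOL-Decision_Procs.Algebra_Aux"
begin

text \<open>
  The spaces \<open>X\<^sub>i\<close> of a family are different spaces in general, and the sum of such a family
  depends on an index set and on a real exponent. The type classes of HOL-Analysis do not cover
  this, so normed spaces are given here by a carrier with operations: a module of HOL-Algebra over
  the ring of real numbers, together with a norm. All members of a family have carriers in one
  type \<open>'a\<close>. This is no restriction, as the carriers can be arbitrary subsets of \<open>'a\<close>, each with
  its own operations, and \<open>'a\<close> can be as large as required.
  The fields \<open>mult\<close> and \<open>one\<close>, which the module record inherits from the ring record, are
  irrelevant.
\<close>

record 'a normed_module = "(real, 'a) module" +
  vnorm :: "'a \<Rightarrow> real" (\<open>(\<open>open_block notation=\<open>mixfix vnorm\<close>\<close>\<parallel>_\<parallel>\<index>)\<close>)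

locale normed_space = Module.module "cring_class_ops :: real ring" V for V (structure) +
  assumes vnorm_eq_zero_iff: "x \<in> carrier V \<Longrightarrow> \<parallel>x\<parallel> = 0 \<longleftrightarrow> x = \<zero>"
    and vnorm_triangle: "x \<in> carrier V \<Longrightarrow> y \<in> carrier V \<Longrightarrow> \<parallel>x \<oplus> y\<parallel> \<le> \<parallel>x\<parallel> + \<parallel>y\<parallel>"
    and vnorm_smult: "x \<in> carrier V \<Longrightarrow> \<parallel>a \<odot> x\<parallel> = \<bar>a\<bar> * \<parallel>x\<parallel>"

locale banach_space = normed_space +
  assumes Cauchy_converges:
    "range \<sigma> \<subseteq> carrier V \<Longrightarrow> (\<And>e. e > 0 \<Longrightarrow> \<exists>N. \<forall>m\<ge>N. \<forall>n\<ge>N. \<parallel>\<sigma> m \<ominus> \<sigma> n\<parallel> < e) \<Longrightarrow>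
      \<exists>x\<in>carrier V. (\<lambda>n. \<parallel>\<sigma> n \<ominus> x\<parallel>) \<longlonglongrightarrow> 0"

definition bounded_functional :: "'a normed_module \<Rightarrow> ('a \<Rightarrow> real) \<Rightarrow> bool" where
  "bounded_functional V f \<longleftrightarrow>
     (\<forall>x\<in>carrier V. \<forall>y\<in>carrier V. f (x \<oplus>\<^bsub>V\<^esub> y) = f x + f y) \<and>
     (\<forall>a. \<forall>x\<in>carrier V. f (a \<odot>\<^bsub>V\<^esub> x) = a * f x) \<and>
     (\<exists>C. \<forall>x\<in>carrier V. \<bar>f x\<bar> \<le> C * \<parallel>x\<parallel>\<^bsub>V\<^esub>)"

definition weakly_null :: "'a normed_module \<Rightarrow> (nat \<Rightarrow> 'a) \<Rightarrow> bool" where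
  "weakly_null V xs \<longleftrightarrow>
     range xs \<subseteq> carrier V \<and> (\<forall>f. bounded_functional V f \<longrightarrow> (\<lambda>n. f (xs n)) \<longlonglongrightarrow> 0)"

text \<open>
  Members of the sum are extensional functions, i.e. they are \<^const>\<open>undefined\<close> outside the index
  set. Thus equality in the carrier is equality of families.
\<close>

definition lp_sum :: "real \<Rightarrow> 'i set \<Rightarrow> ('i \<Rightarrow> 'a normed_module) \<Rightarrow> ('i \<Rightarrow> 'a) normed_module" where
  "lp_sum p I X =
    \<lparr>carrier = {x \<in> (\<Pi>\<^sub>E i\<in>I. carrier (X i)). (\<lambda>i. \<parallel>x i\<parallel>\<^bsub>X i\<^esub> powr p) summable_on I},
     mult = undefined,
     one = undefined,
     zero = (\<lambda>i\<in>I. \<zero>\<^bsub>X i\<^esub>),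
     add = (\<lambda>x y. \<lambda>i\<in>I. x i \<oplus>\<^bsub>X i\<^esub> y i),
     smult = (\<lambda>a x. \<lambda>i\<in>I. a \<odot>\<^bsub>X i\<^esub> x i),
     vnorm = (\<lambda>x. (\<Sum>\<^sub>\<infinity>i\<in>I. \<parallel>x i\<parallel>\<^bsub>X i\<^esub> powr p) powr (1 / p))\<rparr>"

text \<open>
  The modulus \<open>\<eta>\<^sub>V(\<epsilon>, R)\<close>. It is extended real valued: if \<open>V\<close> has no vector of norm at least \<open>\<epsilon>\<close>,
  then the infimum is taken over the empty set and equals \<open>\<infinity>\<close>. No difference \<open>\<infinity> - \<infinity>\<close> occurs,
  as both lower limits are finite due to the bound \<open>R\<close>.
\<close>

definition opial_modulus :: "'a normed_module \<Rightarrow> real \<Rightarrow> real \<Rightarrow> ereal" where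
  "opial_modulus V \<epsilon> R =
    Inf {liminf (\<lambda>n. ereal \<parallel>xs n \<ominus>\<^bsub>V\<^esub> x\<parallel>\<^bsub>V\<^esub>) - liminf (\<lambda>n. ereal \<parallel>xs n\<parallel>\<^bsub>V\<^esub>) | x xs.
      x \<in> carrier V \<and> \<epsilon> \<le> \<parallel>x\<parallel>\<^bsub>V\<^esub> \<and>
      weakly_null V xs \<and> limsup (\<lambda>n. ereal \<parallel>xs n\<parallel>\<^bsub>V\<^esub>) \<le> ereal R}"

definition uniform_opial :: "'a normed_module \<Rightarrow> bool" where
  "uniform_opial V \<longleftrightarrow>
    (\<forall>c>0. \<exists>r>0. \<forall>x\<in>carrier V. \<forall>xs.
      c \<le> \<parallel>x\<parallel>\<^bsub>V\<^esub> \<longrightarrow> weakly_null V xs \<longrightarrow> 1 \<le> liminf (\<lambda>n. ereal \<parallel>xs n\<parallel>\<^bsub>V\<^esub>) \<longrightarrow>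
      ereal (1 + r) \<le> liminf (\<lambda>n. ereal \<parallel>xs n \<ominus>\<^bsub>V\<^esub> x\<parallel>\<^bsub>V\<^esub>))"

end

theory Submission
  imports Defs
begin

text \<open>
  Let \<open>xs\<close> be weakly null in the sum \<open>X\<close> with \<open>\<parallel>xs n\<parallel> \<longlonglongrightarrow> a \<le> R\<close> and \<open>\<parallel>xs n - x\<parallel> \<longlonglongrightarrow> b\<close>, where
  \<open>\<parallel>x\<parallel> \<ge> \<epsilon>\<close>. The core of the proof is that \<open>b - a\<close> is bounded below by a constant \<open>\<theta> > 0\<close> that
  depends on \<open>\<epsilon>\<close> and \<open>R\<close> only (lemma \<open>lp_sum_opial_gap\<close>). Cut the index set at a finite \<open>J\<close> such
  that \<open>x\<close> is smaller than \<open>\<theta>\<close> outside \<open>J\<close> and still has norm at least \<open>\<epsilon> / 2\<close> on \<open>J\<close>, and pass to a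
  subsequence along which all four partial norms converge: the norms of \<open>xs n\<close> on \<open>J\<close> and off \<open>J\<close> to
  \<open>u\<close> and \<open>v\<close>, those of \<open>xs n - x\<close> to \<open>w\<close> and \<open>y\<close>. Then \<open>a\<^sup>p = u\<^sup>p + v\<^sup>p\<close> and
  \<open>b\<^sup>p = w\<^sup>p + y\<^sup>p\<close>. Restriction to \<open>J\<close> preserves weak nullity (\<open>weakly_null_restrict\<close>), so for
  any real \<open>e\<close> with \<open>0 < e < \<omega>(\<epsilon> / 2, R)\<close> we get \<open>w \<ge> u + e\<close>, hence \<open>w\<^sup>p \<ge> u\<^sup>p + e\<^sup>p\<close>.
  Minkowski's inequality off \<open>J\<close> gives \<open>v \<le> y + \<theta>\<close>. The function \<open>t\<^sup>p\<close> is uniformly continuous on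
  bounded intervals, so for small \<open>\<theta>\<close> the tail costs at most \<open>e\<^sup>p / 2\<close>, and
  \<open>b\<^sup>p \<ge> a\<^sup>p + e\<^sup>p / 2\<close>, which forces \<open>b \<ge> a + \<theta>\<close> by uniform continuity again.

  The uniform Opial property concerns sequences with a lower bound on their norms, while the gap
  needs an upper bound \<open>R\<close>. The two are reconciled in \<open>uniform_opial_lp_sumI\<close>: if
  \<open>liminf \<parallel>xs n - x\<parallel>\<close> is below \<open>2\<close>, then a subsequence realising it is bounded, so after refining it
  the norms \<open>\<parallel>xs n\<parallel>\<close> converge to some \<open>a\<close>. The gap for \<open>R = a\<close>, however small, yields
  \<open>a < b \<le> 2\<close>, and now the gap for \<open>R = 2\<close> applies, whose size depends on the lower bound for
  \<open>\<parallel>x\<parallel>\<close> alone.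
\<close>

section \<open>Powers with exponent at least one\<close>

text \<open>
  The endpoint \<open>0\<close> is included because the coordinates of a family may vanish; there the inequality
  reduces to \<open>t powr p \<le> t\<close> for \<open>0 < t < 1\<close>.
\<close>

lemma convex_on_powr_nonneg:
  fixes p :: real
  assumes "1 \<le> p"
  shows "convex_on {0..} (\<lambda>x. x powr p)"
proof (rule convex_onI)
  have scale: "(t * z) powr p \<le> t * z powr p" if "0 < t" "t < 1" for t z :: real
    using that assms powr_le_one_le[of t p] by (simp add: powr_mult mult_right_mono)
  fix t x y :: real
  assume t: "0 < t" "t < 1" and xy: "x \<in> {0..}" "y \<in> {0..}"
  consider "x = 0" | "y = 0" | "0 < x" "0 < y" using xy by fastforce
  then show "((1 - t) *\<^sub>R x + t *\<^sub>R y) powr p \<le> (1 - t) * x powr p + t * y powr p"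
  proof cases
    case 3
    then show ?thesis
      using convex_onD[OF powr_convex[OF assms], of t x y] t by simp
  qed (use scale[of t y] scale[of "1 - t" x] t in auto)
qed (rule convex_real_interval)

lemma powr_superadditive:
  fixes p s t :: real
  assumes "1 \<le> p" "0 \<le> s" "0 \<le> t"
  shows "s powr p + t powr p \<le> (s + t) powr p"
proof -
  have "s powr p + t powr p = s * s powr (p - 1) + t * t powr (p - 1)"
    using assms by (simp add: powr_mult_base)
  also have "\<dots> \<le> s * (s + t) powr (p - 1) + t * (s + t) powr (p - 1)"
    using assms by (intro add_mono mult_left_mono powr_mono2) auto
  also have "\<dots> = (s + t) powr p"
    using assms by (simp add: powr_mult_base flip: distrib_right)
  finally show ?thesis .
qed

text \<open>
  Convexity, applied to \<open>s / A\<close> and \<open>t / B\<close> with weights proportional to \<open>A\<close> and \<open>B\<close>. When \<open>A\<close> and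
  \<open>B\<close> are the norms of two families, summation over the coordinates gives Minkowski's inequality.
\<close>

lemma powr_add_le_weighted:
  fixes p A B s t :: real
  assumes "1 \<le> p" "0 < A" "0 < B" "0 \<le> s" "0 \<le> t"
  shows "(s + t) powr p \<le> (A + B) powr p *
    (A / (A + B) * (s powr p / A powr p) + B / (A + B) * (t powr p / B powr p))"
proof -
  define m where "m = B / (A + B)"
  have m: "0 \<le> m" "m \<le> 1" "1 - m = A / (A + B)"
    using assms by (auto simp: m_def field_simps)
  have "((1 - m) * (s / A) + m * (t / B)) powr p
      \<le> (1 - m) * (s / A) powr p + m * (t / B) powr p"
    using convex_onD[OF convex_on_powr_nonneg[OF assms(1)], of m "s / A" "t / B"] m assms by simp
  moreover have "(1 - m) * (s / A) + m * (t / B) = (s + t) / (A + B)"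
    using assms by (simp add: m(3)) (simp add: m_def add_divide_distrib)
  ultimately have "(s + t) powr p / (A + B) powr p
      \<le> (1 - m) * (s powr p / A powr p) + m * (t powr p / B powr p)"
    by (simp add: powr_divide)
  then show ?thesis
    using assms by (simp add: m(3)) (simp add: m_def field_simps)
qed

section \<open>The \<open>p\<close>-norm of a family of numbers\<close>

definition lp_norm :: "real \<Rightarrow> 'i set \<Rightarrow> ('i \<Rightarrow> real) \<Rightarrow> real" where
  "lp_norm p K f = (\<Sum>\<^sub>\<infinity>i\<in>K. f i powr p) powr (1 / p)"

lemma lp_norm_nonneg [simp]: "0 \<le> lp_norm p K f"
  by (simp add: lp_norm_def)

lemma lp_norm_cong: "(\<And>i. i \<in> K \<Longrightarrow> f i = g i) \<Longrightarrow> lp_norm p K f = lp_norm p K g"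
  unfolding lp_norm_def by (simp cong: infsum_cong)

lemma lp_norm_powr:
  assumes "1 \<le> p"
  shows "lp_norm p K f powr p = (\<Sum>\<^sub>\<infinity>i\<in>K. f i powr p)"
  using assms by (simp add: lp_norm_def powr_powr infsum_nonneg)

lemma lp_norm_leI:
  assumes "1 \<le> p" "0 \<le> A" "(\<Sum>\<^sub>\<infinity>i\<in>K. f i powr p) \<le> A powr p"
  shows "lp_norm p K f \<le> A"
proof -
  have "lp_norm p K f \<le> (A powr p) powr (1 / p)"
    unfolding lp_norm_def using assms by (intro powr_mono2) (auto intro: infsum_nonneg)
  then show ?thesis using assms by (simp add: powr_powr)
qed

text \<open>
  Minkowski's inequality. It is stated for any \<open>h\<close> dominated by \<open>f + g\<close>, as the coordinate norms of a
  sum of vectors are only dominated by the sums of the coordinate norms.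
\<close>

lemma
  fixes f g h :: "'i \<Rightarrow> real"
  assumes p: "1 \<le> p"
    and f: "\<And>i. i \<in> K \<Longrightarrow> 0 \<le> f i" "(\<lambda>i. f i powr p) summable_on K"
    and g: "\<And>i. i \<in> K \<Longrightarrow> 0 \<le> g i" "(\<lambda>i. g i powr p) summable_on K"
    and h: "\<And>i. i \<in> K \<Longrightarrow> 0 \<le> h i" "\<And>i. i \<in> K \<Longrightarrow> h i \<le> f i + g i"
  shows lp_summable_of_le_add: "(\<lambda>i. h i powr p) summable_on K"
    and lp_norm_le_add: "lp_norm p K h \<le> lp_norm p K f + lp_norm p K g"
proof -
  define c where "c A B = (A + B) powr p * (A / (A + B) / A powr p)" for A B :: real
  have bound: "h i powr p \<le> c A B * f i powr p + c B A * g i powr p"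
    if "i \<in> K" "0 < A" "0 < B" for i A B
  proof -
    have "h i powr p \<le> (f i + g i) powr p"
      using h f g that p by (intro powr_mono2) auto
    also have "\<dots> \<le> c A B * f i powr p + c B A * g i powr p"
      using powr_add_le_weighted[OF p that(2,3) f(1)[OF that(1)] g(1)[OF that(1)]]
      by (simp add: c_def algebra_simps)
    finally show ?thesis .
  qed
  have summable: "(\<lambda>i. c A B * f i powr p + c B A * g i powr p) summable_on K" for A B
    by (intro summable_on_add summable_on_cmult_right f g)
  show h_summable: "(\<lambda>i. h i powr p) summable_on K"
    by (rule summable_on_comparison_test[OF summable[of 1 1]]) (use bound[of _ 1 1] in auto)
  show "lp_norm p K h \<le> lp_norm p K f + lp_norm p K g"
  proof (rule field_le_epsilon)
    fix e :: real
    assume e: "0 < e"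
    \<comment> \<open>The weights divide by the two norms, so both are enlarged to be positive.\<close>
    define A where "A = lp_norm p K f + e / 2"
    define B where "B = lp_norm p K g + e / 2"
    have AB: "0 < A" "0 < B" using e by (auto simp: A_def B_def add_nonneg_pos)
    have F: "(\<Sum>\<^sub>\<infinity>i\<in>K. f i powr p) \<le> A powr p" and G: "(\<Sum>\<^sub>\<infinity>i\<in>K. g i powr p) \<le> B powr p"
      unfolding lp_norm_powr[OF p, symmetric] using e p
      by (auto simp: A_def B_def intro!: powr_mono2)
    have "(\<Sum>\<^sub>\<infinity>i\<in>K. h i powr p) \<le> (\<Sum>\<^sub>\<infinity>i\<in>K. c A B * f i powr p + c B A * g i powr p)"
      by (intro infsum_mono h_summable summable bound AB)
    also have "\<dots> = c A B * (\<Sum>\<^sub>\<infinity>i\<in>K. f i powr p) + c B A * (\<Sum>\<^sub>\<infinity>i\<in>K. g i powr p)"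
      by (simp add: infsum_add summable_on_cmult_right f g infsum_cmult_right)
    also have "\<dots> \<le> c A B * A powr p + c B A * B powr p"
      using F G AB by (intro add_mono mult_left_mono) (auto simp: c_def)
    also have "\<dots> = (A + B) powr p * (A / (A + B) + B / (A + B))"
      using AB by (simp add: c_def add.commute[of B A] distrib_left)
    also have "\<dots> = (A + B) powr p"
      using AB by (simp flip: add_divide_distrib)
    finally show "lp_norm p K h \<le> lp_norm p K f + lp_norm p K g + e"
      using lp_norm_leI[OF p, where A = "A + B" and f = h and K = K] AB by (simp add: A_def B_def)
  qed
qed

lemma lp_norm_split:
  assumes "1 \<le> p" "J \<subseteq> K" "(\<lambda>i. f i powr p) summable_on K"
  shows "lp_norm p K f powr p = lp_norm p J f powr p + lp_norm p (K - J) f powr p"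
proof -
  have "(\<lambda>i. f i powr p) summable_on J" "(\<lambda>i. f i powr p) summable_on (K - J)"
    using assms by (auto intro: summable_on_subset_banach)
  then have "(\<Sum>\<^sub>\<infinity>i\<in>J \<union> (K - J). f i powr p)
      = (\<Sum>\<^sub>\<infinity>i\<in>J. f i powr p) + (\<Sum>\<^sub>\<infinity>i\<in>K - J. f i powr p)"
    by (intro infsum_Un_disjoint) auto
  moreover have "J \<union> (K - J) = K" using assms by blast
  ultimately show ?thesis using assms(1) by (simp add: lp_norm_powr)
qed

lemma lp_norm_mono_set:
  assumes "1 \<le> p" "J \<subseteq> K" "(\<lambda>i. f i powr p) summable_on K"
  shows "lp_norm p J f \<le> lp_norm p K f"
  using lp_norm_split[OF assms] assms(1)
  by (intro lp_norm_leI) (simp_all flip: lp_norm_powr)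

text \<open>
  The norms over finite index sets converge to the full norm, so one finite set can carry nearly the
  whole norm and leave a small remainder at the same time.
\<close>

lemma lp_norm_finite_part:
  fixes f :: "'i \<Rightarrow> real"
  assumes p: "1 \<le> p" and f: "(\<lambda>i. f i powr p) summable_on K"
    and \<delta>: "0 < \<delta>" and c: "c < lp_norm p K f"
  obtains J where "finite J" "J \<subseteq> K" "c < lp_norm p J f" "lp_norm p (K - J) f < \<delta>"
proof -
  have "((\<lambda>J. \<Sum>i\<in>J. f i powr p) \<longlongrightarrow> (\<Sum>\<^sub>\<infinity>i\<in>K. f i powr p)) (finite_subsets_at_top K)"
    using f by (rule infsum_tendsto)
  moreover have "\<forall>\<^sub>F J in finite_subsets_at_top K. (\<Sum>i\<in>J. f i powr p) = lp_norm p J f powr p"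
    by (rule eventually_finite_subsets_at_top_weakI) (simp add: lp_norm_powr p)
  ultimately have lim: "((\<lambda>J. lp_norm p J f powr p) \<longlongrightarrow> lp_norm p K f powr p)
      (finite_subsets_at_top K)"
    unfolding lp_norm_powr[OF p] using tendsto_cong by force
  have root: "(x powr p) powr (1 / p) = x" if "0 \<le> x" for x :: real
    using that p by (simp add: powr_powr)
  have "((\<lambda>J. (lp_norm p J f powr p) powr (1 / p)) \<longlongrightarrow> (lp_norm p K f powr p) powr (1 / p))
      (finite_subsets_at_top K)"
    using p by (intro tendsto_powr' lim tendsto_const) auto
  then have "((\<lambda>J. lp_norm p J f) \<longlongrightarrow> lp_norm p K f) (finite_subsets_at_top K)"
    by (simp add: root)
  then have "\<forall>\<^sub>F J in finite_subsets_at_top K. c < lp_norm p J f"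
    using c by (rule order_tendstoD)
  moreover have "\<forall>\<^sub>F J in finite_subsets_at_top K.
      lp_norm p K f powr p - \<delta> powr p < lp_norm p J f powr p"
    using \<delta> by (intro order_tendstoD(1)[OF lim]) simp
  moreover have "\<forall>\<^sub>F J in finite_subsets_at_top K. finite J \<and> J \<subseteq> K"
    by (rule eventually_finite_subsets_at_top_weakI) simp
  ultimately have "\<forall>\<^sub>F J in finite_subsets_at_top K. c < lp_norm p J f \<and>
      lp_norm p K f powr p - \<delta> powr p < lp_norm p J f powr p \<and> finite J \<and> J \<subseteq> K"
    by eventually_elim auto
  then obtain J where J: "c < lp_norm p J f" "finite J" "J \<subseteq> K"
      "lp_norm p K f powr p - \<delta> powr p < lp_norm p J f powr p"
    using eventually_happens[of _ "finite_subsets_at_top K"] by auto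
  have "lp_norm p (K - J) f powr p < \<delta> powr p"
    using lp_norm_split[OF p J(3) f] J(4) by simp
  then have "lp_norm p (K - J) f < \<delta>"
    using powr_mono2[of p \<delta> "lp_norm p (K - J) f"] p \<delta> by force
  with J that show thesis by blast
qed

section \<open>Normed spaces and their sums\<close>

context normed_space
begin

lemma smult_minus_one:
  assumes "x \<in> carrier V"
  shows "(- 1) \<odot> x = \<ominus> x"
  using smult_l_minus[of 1 x] smult_one[of x] assms by (simp add: class_simps)

lemma vnorm_uminus:
  assumes "x \<in> carrier V"
  shows "\<parallel>\<ominus> x\<parallel> = \<parallel>x\<parallel>"
  using vnorm_smult[OF assms, of "- 1"] by (simp add: smult_minus_one assms)

lemma vnorm_nonneg:
  assumes "x \<in> carrier V"
  shows "0 \<le> \<parallel>x\<parallel>"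
  using vnorm_triangle[of x "\<ominus> x"] vnorm_eq_zero_iff[of \<zero>] assms by (simp add: vnorm_uminus M.r_neg)

lemma vnorm_minus_le:
  assumes "x \<in> carrier V" "y \<in> carrier V"
  shows "\<parallel>x \<ominus> y\<parallel> \<le> \<parallel>x\<parallel> + \<parallel>y\<parallel>"
  using vnorm_triangle[of x "\<ominus> y"] assms by (simp add: vnorm_uminus M.minus_eq)

lemma vnorm_le_minus:
  assumes "x \<in> carrier V" "y \<in> carrier V"
  shows "\<parallel>x\<parallel> \<le> \<parallel>x \<ominus> y\<parallel> + \<parallel>y\<parallel>"
  using vnorm_triangle[of "x \<ominus> y" y] assms by (simp add: M.minus_eq M.a_assoc M.l_neg)

end

lemma lp_sum_simps:
  "carrier (lp_sum p K X) =
     {x \<in> (\<Pi>\<^sub>E i\<in>K. carrier (X i)). (\<lambda>i. \<parallel>x i\<parallel>\<^bsub>X i\<^esub> powr p) summable_on K}"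
  "\<zero>\<^bsub>lp_sum p K X\<^esub> = (\<lambda>i\<in>K. \<zero>\<^bsub>X i\<^esub>)"
  "x \<oplus>\<^bsub>lp_sum p K X\<^esub> y = (\<lambda>i\<in>K. x i \<oplus>\<^bsub>X i\<^esub> y i)"
  "a \<odot>\<^bsub>lp_sum p K X\<^esub> x = (\<lambda>i\<in>K. a \<odot>\<^bsub>X i\<^esub> x i)"
  "\<parallel>x\<parallel>\<^bsub>lp_sum p K X\<^esub> = lp_norm p K (\<lambda>i. \<parallel>x i\<parallel>\<^bsub>X i\<^esub>)"
  by (simp_all add: lp_sum_def lp_norm_def)

lemma lp_sumD:
  assumes "x \<in> carrier (lp_sum p K X)"
  shows "i \<in> K \<Longrightarrow> x i \<in> carrier (X i)"
    and "(\<lambda>i. \<parallel>x i\<parallel>\<^bsub>X i\<^esub> powr p) summable_on K"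
    and "x \<in> extensional K"
  using assms by (auto simp: lp_sum_simps PiE_def)

lemma lp_sum_restrict:
  assumes "x \<in> carrier (lp_sum p K X)" "J \<subseteq> K"
  shows "restrict x J \<in> carrier (lp_sum p J X)"
proof -
  have "(\<lambda>i. \<parallel>x i\<parallel>\<^bsub>X i\<^esub> powr p) summable_on J"
    using lp_sumD(2)[OF assms(1)] assms(2) by (rule summable_on_subset_banach)
  then have "(\<lambda>i. \<parallel>restrict x J i\<parallel>\<^bsub>X i\<^esub> powr p) summable_on J"
    by (simp cong: summable_on_cong)
  then show ?thesis
    using lp_sumD(1)[OF assms(1)] assms(2) by (auto simp: lp_sum_simps)
qed

locale normed_family =
  fixes p :: real and I :: "'i set" and X :: "'i \<Rightarrow> 'a normed_module"
  assumes p: "1 \<le> p"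
    and normed: "\<And>i. i \<in> I \<Longrightarrow> normed_space (X i)"
begin

text \<open>
  Subtraction in a module is defined through the inverse, which is a definite description over the
  carrier. The coordinatewise inverse satisfies it, and does so uniquely.
\<close>

lemma lp_sum_uminus:
  assumes K: "K \<subseteq> I" and y: "y \<in> carrier (lp_sum p K X)"
  shows "\<ominus>\<^bsub>lp_sum p K X\<^esub> y = (\<lambda>i\<in>K. \<ominus>\<^bsub>X i\<^esub> y i)"
proof -
  let ?S = "lp_sum p K X"
  have group: "abelian_group (X i)" and yi: "y i \<in> carrier (X i)"
    and norm: "\<parallel>\<ominus>\<^bsub>X i\<^esub> y i\<parallel>\<^bsub>X i\<^esub> = \<parallel>y i\<parallel>\<^bsub>X i\<^esub>" if "i \<in> K" for i
  proof -
    interpret normed_space "X i" using normed K that by blast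
    show "abelian_group (X i)" ..
    show "y i \<in> carrier (X i)" using lp_sumD(1)[OF y that] .
    then show "\<parallel>\<ominus>\<^bsub>X i\<^esub> y i\<parallel>\<^bsub>X i\<^esub> = \<parallel>y i\<parallel>\<^bsub>X i\<^esub>" by (rule vnorm_uminus)
  qed
  have "(\<lambda>i. \<parallel>(\<lambda>i\<in>K. \<ominus>\<^bsub>X i\<^esub> y i) i\<parallel>\<^bsub>X i\<^esub> powr p) summable_on K"
    using lp_sumD(2)[OF y] by (simp add: norm cong: summable_on_cong)
  then have closed: "(\<lambda>i\<in>K. \<ominus>\<^bsub>X i\<^esub> y i) \<in> carrier ?S"
    using group yi by (auto simp: lp_sum_simps abelian_group.a_inv_closed)
  have unique: "z = (\<lambda>i\<in>K. \<ominus>\<^bsub>X i\<^esub> y i)"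
    if z: "z \<in> carrier ?S" and sum: "z \<oplus>\<^bsub>?S\<^esub> y = \<zero>\<^bsub>?S\<^esub>" for z
  proof (rule extensionalityI[OF lp_sumD(3)[OF z] restrict_extensional])
    fix i
    assume i: "i \<in> K"
    have "z i \<oplus>\<^bsub>X i\<^esub> y i = \<zero>\<^bsub>X i\<^esub>"
      using fun_cong[OF sum, of i] i by (simp add: lp_sum_simps)
    then show "z i = (\<lambda>i\<in>K. \<ominus>\<^bsub>X i\<^esub> y i) i"
      using abelian_group.minus_equality[OF group[OF i]] yi[OF i] lp_sumD(1)[OF z i] i by force
  qed
  have "(THE z. z \<in> carrier ?S \<and> y \<oplus>\<^bsub>?S\<^esub> z = \<zero>\<^bsub>?S\<^esub> \<and> z \<oplus>\<^bsub>?S\<^esub> y = \<zero>\<^bsub>?S\<^esub>)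
      = (\<lambda>i\<in>K. \<ominus>\<^bsub>X i\<^esub> y i)"
  proof (rule the_equality)
    show "(\<lambda>i\<in>K. \<ominus>\<^bsub>X i\<^esub> y i) \<in> carrier ?S \<and>
        y \<oplus>\<^bsub>?S\<^esub> (\<lambda>i\<in>K. \<ominus>\<^bsub>X i\<^esub> y i) = \<zero>\<^bsub>?S\<^esub> \<and> (\<lambda>i\<in>K. \<ominus>\<^bsub>X i\<^esub> y i) \<oplus>\<^bsub>?S\<^esub> y = \<zero>\<^bsub>?S\<^esub>"
      using closed group yi
      by (auto simp: lp_sum_simps abelian_group.r_neg abelian_group.l_neg restrict_def)
  qed (use unique in blast)
  then show ?thesis
    by (simp add: a_inv_def m_inv_def)
qed

lemma lp_sum_minus:
  assumes K: "K \<subseteq> I" and y: "y \<in> carrier (lp_sum p K X)"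
  shows "x \<ominus>\<^bsub>lp_sum p K X\<^esub> y = (\<lambda>i\<in>K. x i \<ominus>\<^bsub>X i\<^esub> y i)"
  by (simp add: a_minus_def lp_sum_uminus[OF K y]) (auto simp: lp_sum_simps restrict_def fun_eq_iff)

lemma vnorm_lp_sum_minus:
  assumes K: "K \<subseteq> I" and y: "y \<in> carrier (lp_sum p K X)"
  shows "\<parallel>x \<ominus>\<^bsub>lp_sum p K X\<^esub> y\<parallel>\<^bsub>lp_sum p K X\<^esub> = lp_norm p K (\<lambda>i. \<parallel>x i \<ominus>\<^bsub>X i\<^esub> y i\<parallel>\<^bsub>X i\<^esub>)"
  unfolding lp_sum_minus[OF K y] by (simp add: lp_sum_simps cong: lp_norm_cong)

lemma
  assumes x: "x \<in> carrier (lp_sum p I X)" and y: "y \<in> carrier (lp_sum p I X)" and K: "K \<subseteq> I"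
  shows lp_sum_minus_summable: "(\<lambda>i. \<parallel>x i \<ominus>\<^bsub>X i\<^esub> y i\<parallel>\<^bsub>X i\<^esub> powr p) summable_on K"
    and lp_sum_norm_le_minus: "lp_norm p K (\<lambda>i. \<parallel>x i\<parallel>\<^bsub>X i\<^esub>)
      \<le> lp_norm p K (\<lambda>i. \<parallel>x i \<ominus>\<^bsub>X i\<^esub> y i\<parallel>\<^bsub>X i\<^esub>) + lp_norm p K (\<lambda>i. \<parallel>y i\<parallel>\<^bsub>X i\<^esub>)"
proof -
  have *: "0 \<le> \<parallel>x i\<parallel>\<^bsub>X i\<^esub>" "0 \<le> \<parallel>y i\<parallel>\<^bsub>X i\<^esub>" "0 \<le> \<parallel>x i \<ominus>\<^bsub>X i\<^esub> y i\<parallel>\<^bsub>X i\<^esub>"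
      "\<parallel>x i \<ominus>\<^bsub>X i\<^esub> y i\<parallel>\<^bsub>X i\<^esub> \<le> \<parallel>x i\<parallel>\<^bsub>X i\<^esub> + \<parallel>y i\<parallel>\<^bsub>X i\<^esub>"
      "\<parallel>x i\<parallel>\<^bsub>X i\<^esub> \<le> \<parallel>x i \<ominus>\<^bsub>X i\<^esub> y i\<parallel>\<^bsub>X i\<^esub> + \<parallel>y i\<parallel>\<^bsub>X i\<^esub>" if "i \<in> K" for i
  proof -
    interpret normed_space "X i" using normed K that by blast
    have "x i \<in> carrier (X i)" "y i \<in> carrier (X i)"
      using lp_sumD(1)[OF x] lp_sumD(1)[OF y] that K by auto
    then show "0 \<le> \<parallel>x i\<parallel>\<^bsub>X i\<^esub>" "0 \<le> \<parallel>y i\<parallel>\<^bsub>X i\<^esub>" "0 \<le> \<parallel>x i \<ominus>\<^bsub>X i\<^esub> y i\<parallel>\<^bsub>X i\<^esub>"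
      "\<parallel>x i \<ominus>\<^bsub>X i\<^esub> y i\<parallel>\<^bsub>X i\<^esub> \<le> \<parallel>x i\<parallel>\<^bsub>X i\<^esub> + \<parallel>y i\<parallel>\<^bsub>X i\<^esub>"
      "\<parallel>x i\<parallel>\<^bsub>X i\<^esub> \<le> \<parallel>x i \<ominus>\<^bsub>X i\<^esub> y i\<parallel>\<^bsub>X i\<^esub> + \<parallel>y i\<parallel>\<^bsub>X i\<^esub>"
      by (auto intro: vnorm_nonneg vnorm_minus_le vnorm_le_minus)
  qed
  have summable: "(\<lambda>i. \<parallel>x i\<parallel>\<^bsub>X i\<^esub> powr p) summable_on K" "(\<lambda>i. \<parallel>y i\<parallel>\<^bsub>X i\<^esub> powr p) summable_on K"
    using lp_sumD(2)[OF x] lp_sumD(2)[OF y] K by (auto intro: summable_on_subset_banach)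
  show minus: "(\<lambda>i. \<parallel>x i \<ominus>\<^bsub>X i\<^esub> y i\<parallel>\<^bsub>X i\<^esub> powr p) summable_on K"
    by (rule lp_summable_of_le_add[OF p _ summable(1) _ summable(2)]) (use * in auto)
  show "lp_norm p K (\<lambda>i. \<parallel>x i\<parallel>\<^bsub>X i\<^esub>)
      \<le> lp_norm p K (\<lambda>i. \<parallel>x i \<ominus>\<^bsub>X i\<^esub> y i\<parallel>\<^bsub>X i\<^esub>) + lp_norm p K (\<lambda>i. \<parallel>y i\<parallel>\<^bsub>X i\<^esub>)"
    by (rule lp_norm_le_add[OF p _ minus _ summable(2)]) (use * in auto)
qed

text \<open>
  A bounded functional on the smaller sum, composed with the restriction map, is a bounded functional
  on the larger one, since restriction is linear and does not increase the norm.
\<close>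

lemma weakly_null_restrict:
  assumes xs: "weakly_null (lp_sum p I X) xs" and J: "J \<subseteq> I"
  shows "weakly_null (lp_sum p J X) (\<lambda>n. restrict (xs n) J)"
  unfolding weakly_null_def
proof (intro conjI allI impI)
  let ?S = "lp_sum p I X" and ?T = "lp_sum p J X"
  have car: "xs n \<in> carrier ?S" for n using xs by (auto simp: weakly_null_def)
  then show "range (\<lambda>n. restrict (xs n) J) \<subseteq> carrier ?T"
    using lp_sum_restrict[OF _ J] by auto
  fix f
  assume f: "bounded_functional ?T f"
  then obtain C where C: "\<And>x. x \<in> carrier ?T \<Longrightarrow> \<bar>f x\<bar> \<le> C * \<parallel>x\<parallel>\<^bsub>?T\<^esub>"
    unfolding bounded_functional_def by blast
  have f_add: "f (x \<oplus>\<^bsub>?T\<^esub> y) = f x + f y" if "x \<in> carrier ?T" "y \<in> carrier ?T" for x y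
    using f that by (auto simp: bounded_functional_def)
  have f_smult: "f (a \<odot>\<^bsub>?T\<^esub> x) = a * f x" if "x \<in> carrier ?T" for a x
    using f that by (auto simp: bounded_functional_def)
  have "bounded_functional ?S (\<lambda>x. f (restrict x J))"
    unfolding bounded_functional_def
  proof (intro conjI ballI allI)
    fix x y
    assume "x \<in> carrier ?S" "y \<in> carrier ?S"
    then have "f (restrict x J \<oplus>\<^bsub>?T\<^esub> restrict y J) = f (restrict x J) + f (restrict y J)"
      by (intro f_add lp_sum_restrict[OF _ J])
    moreover have "restrict (x \<oplus>\<^bsub>?S\<^esub> y) J = restrict x J \<oplus>\<^bsub>?T\<^esub> restrict y J"
      using J by (auto simp: lp_sum_simps restrict_def fun_eq_iff)
    ultimately show "f (restrict (x \<oplus>\<^bsub>?S\<^esub> y) J) = f (restrict x J) + f (restrict y J)" by simp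
  next
    fix a x
    assume "x \<in> carrier ?S"
    then have "f (a \<odot>\<^bsub>?T\<^esub> restrict x J) = a * f (restrict x J)"
      by (intro f_smult lp_sum_restrict[OF _ J])
    moreover have "restrict (a \<odot>\<^bsub>?S\<^esub> x) J = a \<odot>\<^bsub>?T\<^esub> restrict x J"
      using J by (auto simp: lp_sum_simps restrict_def fun_eq_iff)
    ultimately show "f (restrict (a \<odot>\<^bsub>?S\<^esub> x) J) = a * f (restrict x J)" by simp
  next
    have "\<bar>f (restrict x J)\<bar> \<le> \<bar>C\<bar> * \<parallel>x\<parallel>\<^bsub>?S\<^esub>" if x: "x \<in> carrier ?S" for x
    proof -
      have "\<bar>f (restrict x J)\<bar> \<le> C * \<parallel>restrict x J\<parallel>\<^bsub>?T\<^esub>"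
        by (rule C[OF lp_sum_restrict[OF x J]])
      also have "\<dots> \<le> \<bar>C\<bar> * \<parallel>restrict x J\<parallel>\<^bsub>?T\<^esub>"
        by (intro mult_right_mono) (auto simp: lp_sum_simps)
      also have "\<parallel>restrict x J\<parallel>\<^bsub>?T\<^esub> = lp_norm p J (\<lambda>i. \<parallel>x i\<parallel>\<^bsub>X i\<^esub>)"
        by (simp add: lp_sum_simps cong: lp_norm_cong)
      also have "\<bar>C\<bar> * \<dots> \<le> \<bar>C\<bar> * \<parallel>x\<parallel>\<^bsub>?S\<^esub>"
        using lp_norm_mono_set[OF p J lp_sumD(2)[OF x]]
        by (simp add: lp_sum_simps mult_left_mono)
      finally show ?thesis .
    qed
    then show "\<exists>C. \<forall>x\<in>carrier ?S. \<bar>f (restrict x J)\<bar> \<le> C * \<parallel>x\<parallel>\<^bsub>?S\<^esub>" by blast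
  qed
  then show "(\<lambda>n. f (restrict (xs n) J)) \<longlonglongrightarrow> 0"
    using xs by (auto simp: weakly_null_def)
qed

end

section \<open>Passing the Opial modulus to the sum\<close>

lemma weakly_null_subseq:
  assumes "weakly_null V xs" "strict_mono s"
  shows "weakly_null V (xs \<circ> s)"
  unfolding weakly_null_def
proof (intro conjI allI impI)
  show "range (xs \<circ> s) \<subseteq> carrier V" using assms(1) by (auto simp: weakly_null_def)
  fix f
  assume "bounded_functional V f"
  then have "(\<lambda>n. f (xs n)) \<longlonglongrightarrow> 0" using assms(1) by (auto simp: weakly_null_def)
  from LIMSEQ_subseq_LIMSEQ[OF this assms(2)] show "(\<lambda>n. f ((xs \<circ> s) n)) \<longlonglongrightarrow> 0"
    by (simp add: o_def)
qed

text \<open>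
  For sequences whose norms converge, this says that \<open>\<theta>\<close> is a lower bound for the Opial modulus at
  \<open>\<epsilon>\<close> and \<open>R\<close>. Real limits in place of lower limits allow calculations with \<open>p\<close>-th powers, and
  subsequences reduce the general case to this one.
\<close>

definition opial_gap :: "'a normed_module \<Rightarrow> real \<Rightarrow> real \<Rightarrow> real \<Rightarrow> bool" where
  "opial_gap V \<epsilon> R \<theta> \<longleftrightarrow>
    (\<forall>x\<in>carrier V. \<forall>xs a b. \<epsilon> \<le> \<parallel>x\<parallel>\<^bsub>V\<^esub> \<longrightarrow> weakly_null V xs \<longrightarrow>
      (\<lambda>n. \<parallel>xs n\<parallel>\<^bsub>V\<^esub>) \<longlonglongrightarrow> a \<longrightarrow> a \<le> R \<longrightarrow> (\<lambda>n. \<parallel>xs n \<ominus>\<^bsub>V\<^esub> x\<parallel>\<^bsub>V\<^esub>) \<longlonglongrightarrow> b \<longrightarrow> a + \<theta> \<le> b)"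

lemma opial_gapD:
  assumes "opial_gap V \<epsilon> R \<theta>" "x \<in> carrier V" "\<epsilon> \<le> \<parallel>x\<parallel>\<^bsub>V\<^esub>" "weakly_null V xs"
    "(\<lambda>n. \<parallel>xs n\<parallel>\<^bsub>V\<^esub>) \<longlonglongrightarrow> a" "a \<le> R" "(\<lambda>n. \<parallel>xs n \<ominus>\<^bsub>V\<^esub> x\<parallel>\<^bsub>V\<^esub>) \<longlonglongrightarrow> b"
  shows "a + \<theta> \<le> b"
  using assms unfolding opial_gap_def by blast

lemma opial_gap_modulus:
  assumes modulus: "ereal e \<le> opial_modulus V \<epsilon> R"
  shows "opial_gap V \<epsilon> R e"
  unfolding opial_gap_def
proof (intro ballI allI impI)
  fix x xs u w
  assume x: "x \<in> carrier V" "\<epsilon> \<le> \<parallel>x\<parallel>\<^bsub>V\<^esub>"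
    and xs: "weakly_null V xs"
    and u: "(\<lambda>n. \<parallel>xs n\<parallel>\<^bsub>V\<^esub>) \<longlonglongrightarrow> u" "u \<le> R"
    and w: "(\<lambda>n. \<parallel>xs n \<ominus>\<^bsub>V\<^esub> x\<parallel>\<^bsub>V\<^esub>) \<longlonglongrightarrow> w"
  have U: "liminf (\<lambda>n. ereal \<parallel>xs n\<parallel>\<^bsub>V\<^esub>) = ereal u" "limsup (\<lambda>n. ereal \<parallel>xs n\<parallel>\<^bsub>V\<^esub>) = ereal u"
    using u(1) by (auto intro!: lim_imp_Liminf lim_imp_Limsup)
  have W: "liminf (\<lambda>n. ereal \<parallel>xs n \<ominus>\<^bsub>V\<^esub> x\<parallel>\<^bsub>V\<^esub>) = ereal w"
    using w by (auto intro!: lim_imp_Liminf)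
  have "opial_modulus V \<epsilon> R
      \<le> liminf (\<lambda>n. ereal \<parallel>xs n \<ominus>\<^bsub>V\<^esub> x\<parallel>\<^bsub>V\<^esub>) - liminf (\<lambda>n. ereal \<parallel>xs n\<parallel>\<^bsub>V\<^esub>)"
    unfolding opial_modulus_def using x xs u(2) U(2)
    by (intro Inf_lower CollectI exI[of _ x] exI[of _ xs]) auto
  also have "\<dots> = ereal (w - u)" by (simp add: U W)
  finally have "ereal e \<le> ereal (w - u)" using modulus by (rule order_trans[rotated])
  then show "u + e \<le> w" by simp
qed

context normed_family
begin

text \<open>
  The \<open>p\<close>-th powers of the norms on a finite set \<open>J\<close> and off it add up. On \<open>J\<close>, subtracting \<open>x\<close>
  raises the power by at least \<open>e powr p\<close>; off \<open>J\<close>, where \<open>x\<close> is small, it lowers the power by at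
  most half of that. The hypothesis is needed at \<open>\<epsilon> / 2\<close>, as the part of \<open>x\<close> on \<open>J\<close> may have a norm
  below \<open>\<epsilon>\<close>.
\<close>

lemma lp_sum_opial_gap:
  fixes \<epsilon> R e :: real
  assumes pos: "0 < \<epsilon>" "0 < R" "0 < e"
    and gap_J: "\<And>J. J \<subseteq> I \<Longrightarrow> finite J \<Longrightarrow> opial_gap (lp_sum p J X) (\<epsilon> / 2) R e"
  shows "\<exists>\<theta>>0. opial_gap (lp_sum p I X) \<epsilon> R \<theta>"
proof -
  let ?S = "lp_sum p I X"
  \<comment> \<open>The interval reaches beyond \<open>R\<close> so that it contains \<open>s + \<theta>\<close> for every \<open>s \<le> R\<close>.\<close>
  have "uniformly_continuous_on {0..R + 1} (\<lambda>t. t powr p)"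
    using p by (intro compact_uniformly_continuous continuous_on_powr' continuous_intros) auto
  moreover have "0 < e powr p / 2" using pos by simp
  ultimately obtain d where d: "0 < d"
    and unif: "\<And>s t. s \<in> {0..R + 1} \<Longrightarrow> t \<in> {0..R + 1} \<Longrightarrow> dist t s < d \<Longrightarrow>
      dist (t powr p) (s powr p) < e powr p / 2"
    unfolding uniformly_continuous_on_def by metis
  define \<theta> where "\<theta> = min (d / 2) (1 / 2)"
  have \<theta>: "0 < \<theta>" "\<theta> \<le> 1" "\<theta> < d" using d by (auto simp: \<theta>_def)
  have gap: "t powr p < s powr p + e powr p / 2"
    if "0 \<le> s" "s \<le> R" "0 \<le> t" "t \<le> s + \<theta>" for s t
  proof -
    have "t powr p \<le> (s + \<theta>) powr p" using that p by (intro powr_mono2) auto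
    moreover have "dist ((s + \<theta>) powr p) (s powr p) < e powr p / 2"
      using that \<theta> by (intro unif) (auto simp: dist_real_def)
    ultimately show ?thesis unfolding dist_real_def by linarith
  qed
  have "a + \<theta> \<le> b"
    if x: "x \<in> carrier ?S" and x_norm: "\<epsilon> \<le> \<parallel>x\<parallel>\<^bsub>?S\<^esub>" and xs: "weakly_null ?S xs"
      and a: "(\<lambda>n. \<parallel>xs n\<parallel>\<^bsub>?S\<^esub>) \<longlonglongrightarrow> a" "a \<le> R"
      and b: "(\<lambda>n. \<parallel>xs n \<ominus>\<^bsub>?S\<^esub> x\<parallel>\<^bsub>?S\<^esub>) \<longlonglongrightarrow> b" for x xs a b
  proof -
    have car: "xs n \<in> carrier ?S" for n using xs by (auto simp: weakly_null_def)
    have "\<epsilon> / 2 < lp_norm p I (\<lambda>i. \<parallel>x i\<parallel>\<^bsub>X i\<^esub>)" using x_norm pos by (simp add: lp_sum_simps)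
    from lp_norm_finite_part[OF p lp_sumD(2)[OF x] \<theta>(1) this]
    obtain J where J: "finite J" "J \<subseteq> I" "\<epsilon> / 2 < lp_norm p J (\<lambda>i. \<parallel>x i\<parallel>\<^bsub>X i\<^esub>)"
      "lp_norm p (I - J) (\<lambda>i. \<parallel>x i\<parallel>\<^bsub>X i\<^esub>) < \<theta>" .
    define N where "N K n = lp_norm p K (\<lambda>i. \<parallel>xs n i\<parallel>\<^bsub>X i\<^esub>)" for K n
    define D where "D K n = lp_norm p K (\<lambda>i. \<parallel>xs n i \<ominus>\<^bsub>X i\<^esub> x i\<parallel>\<^bsub>X i\<^esub>)" for K n
    have aN: "N I \<longlonglongrightarrow> a" using a(1) by (simp add: N_def[abs_def] lp_sum_simps)
    have bD: "D I \<longlonglongrightarrow> b" using b by (simp add: D_def[abs_def] vnorm_lp_sum_minus[OF subset_refl x])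
    have nonneg: "0 \<le> N K n" "0 \<le> D K n" for K n by (simp_all add: N_def D_def)
    have le: "N K n \<le> N I n" "D K n \<le> D I n" if "K \<subseteq> I" for K n
      unfolding N_def D_def
      by (rule lp_norm_mono_set[OF p that lp_sumD(2)[OF car]]
        lp_norm_mono_set[OF p that lp_sum_minus_summable[OF car x subset_refl]])+
    have split: "N I n powr p = N J n powr p + N (I - J) n powr p"
      "D I n powr p = D J n powr p + D (I - J) n powr p" for n
      unfolding N_def D_def
      by (rule lp_norm_split[OF p J(2) lp_sumD(2)[OF car]]
        lp_norm_split[OF p J(2) lp_sum_minus_summable[OF car x subset_refl]])+
    obtain A where A: "\<And>n. N I n \<le> A"
      using convergent_imp_Bseq[OF convergentI[OF aN]] by (fastforce simp: Bseq_def abs_le_iff)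
    obtain B where B: "\<And>n. D I n \<le> B"
      using convergent_imp_Bseq[OF convergentI[OF bD]] by (fastforce simp: Bseq_def abs_le_iff)
    \<comment> \<open>One subsequence must serve all four norms, so compactness is used in the product space.\<close>
    define q where "q n = (N J n, N (I - J) n, D J n, D (I - J) n)" for n
    have "range q \<subseteq> {0..A} \<times> {0..A} \<times> {0..B} \<times> {0..B}"
      using nonneg le[OF J(2)] le[OF Diff_subset] A B by (fastforce simp: q_def intro: order_trans)
    then have "bounded (range q)"
      by (rule bounded_subset[rotated]) (intro bounded_Times bounded_closed_interval)
    then obtain l s where s: "strict_mono s" and l: "(q \<circ> s) \<longlonglongrightarrow> l"
      using bounded_imp_convergent_subsequence by blast
    obtain u v w y where l_eq: "l = (u, v, w, y)" by (cases l)
    have uvwy: "(\<lambda>n. N J (s n)) \<longlonglongrightarrow> u" "(\<lambda>n. N (I - J) (s n)) \<longlonglongrightarrow> v"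
      "(\<lambda>n. D J (s n)) \<longlonglongrightarrow> w" "(\<lambda>n. D (I - J) (s n)) \<longlonglongrightarrow> y"
      using tendsto_fst[OF l] tendsto_fst[OF tendsto_snd[OF l]]
        tendsto_fst[OF tendsto_snd[OF tendsto_snd[OF l]]]
        tendsto_snd[OF tendsto_snd[OF tendsto_snd[OF l]]]
      by (simp_all add: l_eq q_def o_def)
    have ab: "(\<lambda>n. N I (s n)) \<longlonglongrightarrow> a" "(\<lambda>n. D I (s n)) \<longlonglongrightarrow> b"
      using LIMSEQ_subseq_LIMSEQ[OF aN s] LIMSEQ_subseq_LIMSEQ[OF bD s] by (simp_all add: o_def)
    have lim_nonneg: "0 \<le> a" "0 \<le> b" "0 \<le> u" "0 \<le> v" "0 \<le> w" "0 \<le> y"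
      using uvwy ab by (auto intro: LIMSEQ_le_const simp: nonneg)
    have powr_lim: "(\<lambda>n. f n powr p) \<longlonglongrightarrow> c powr p" if "f \<longlonglongrightarrow> c" "\<And>n. 0 \<le> f n" for f c
      using that p by (intro tendsto_powr' tendsto_const) auto
    have a_split: "a powr p = u powr p + v powr p"
    proof (rule LIMSEQ_unique)
      show "(\<lambda>n. N I (s n) powr p) \<longlonglongrightarrow> a powr p" by (intro powr_lim ab nonneg)
      show "(\<lambda>n. N I (s n) powr p) \<longlonglongrightarrow> u powr p + v powr p"
        unfolding split by (intro tendsto_add powr_lim uvwy nonneg)
    qed
    have b_split: "b powr p = w powr p + y powr p"
    proof (rule LIMSEQ_unique)
      show "(\<lambda>n. D I (s n) powr p) \<longlonglongrightarrow> b powr p" by (intro powr_lim ab nonneg)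
      show "(\<lambda>n. D I (s n) powr p) \<longlonglongrightarrow> w powr p + y powr p"
        unfolding split by (intro tendsto_add powr_lim uvwy nonneg)
    qed
    have "u \<le> a" "v \<le> a"
      using uvwy ab le[OF J(2)] le[OF Diff_subset] by (auto intro: LIMSEQ_le)
    have "u + e \<le> w"
    proof (rule opial_gapD[OF gap_J[OF J(2,1)]])
      show car_xJ: "restrict x J \<in> carrier (lp_sum p J X)" by (rule lp_sum_restrict[OF x J(2)])
      show "\<epsilon> / 2 \<le> \<parallel>restrict x J\<parallel>\<^bsub>lp_sum p J X\<^esub>"
        using J(3) by (simp add: lp_sum_simps cong: lp_norm_cong)
      show "weakly_null (lp_sum p J X) (\<lambda>n. restrict ((xs \<circ> s) n) J)"
        by (intro weakly_null_restrict weakly_null_subseq xs s J)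
      show "(\<lambda>n. \<parallel>restrict ((xs \<circ> s) n) J\<parallel>\<^bsub>lp_sum p J X\<^esub>) \<longlonglongrightarrow> u"
        using uvwy(1) by (simp add: N_def lp_sum_simps cong: lp_norm_cong)
      show "u \<le> R" using \<open>u \<le> a\<close> a(2) by simp
      show "(\<lambda>n. \<parallel>restrict ((xs \<circ> s) n) J \<ominus>\<^bsub>lp_sum p J X\<^esub> restrict x J\<parallel>\<^bsub>lp_sum p J X\<^esub>) \<longlonglongrightarrow> w"
        using uvwy(3) by (simp add: D_def vnorm_lp_sum_minus[OF J(2) car_xJ] cong: lp_norm_cong)
    qed
    have "N (I - J) n \<le> D (I - J) n + \<theta>" for n
      using lp_sum_norm_le_minus[OF car x, of "I - J" n] J(4) by (simp add: N_def D_def)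
    then have "v \<le> y + \<theta>"
      by (intro LIMSEQ_le[OF uvwy(2) tendsto_add[OF uvwy(4) tendsto_const]]) auto
    \<comment> \<open>The bound \<open>a \<le> R\<close> controls \<open>y\<close> only if \<open>y < v\<close>; otherwise the tail costs nothing.\<close>
    have tail: "v powr p \<le> y powr p + e powr p / 2"
    proof (cases "v \<le> y")
      case True
      then have "v powr p \<le> y powr p" using lim_nonneg p by (intro powr_mono2) auto
      then show ?thesis by (simp add: add_increasing2)
    next
      case False
      then show ?thesis
        using gap[of y v] \<open>v \<le> y + \<theta>\<close> \<open>v \<le> a\<close> a(2) lim_nonneg by simp
    qed
    have "u powr p + e powr p \<le> (u + e) powr p"
      using lim_nonneg pos by (intro powr_superadditive p) auto
    also have "\<dots> \<le> w powr p"
      using \<open>u + e \<le> w\<close> lim_nonneg pos p by (intro powr_mono2) auto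
    finally have "a powr p + e powr p / 2 \<le> b powr p"
      using tail a_split b_split by simp
    \<comment> \<open>If \<open>b\<close> were less than \<open>a + \<theta>\<close>, then \<open>b powr p\<close> would be less than this lower bound.\<close>
    then show "a + \<theta> \<le> b"
      using gap[of a b] a(2) lim_nonneg by force
  qed
  then have "opial_gap ?S \<epsilon> R \<theta>" unfolding opial_gap_def by blast
  with \<theta>(1) show ?thesis by blast
qed

text \<open>
  The constant \<open>r\<close> has to be independent of the sequence, whose norms have no given upper bound. A
  qualitative use of the gap, at the limit of the norms itself, shows that \<open>2\<close> is an upper bound in
  every critical case.
\<close>

lemma uniform_opial_lp_sumI:
  assumes gap: "\<And>\<epsilon> R :: real. 0 < \<epsilon> \<Longrightarrow> 0 < R \<Longrightarrow> \<exists>\<theta>>0. opial_gap (lp_sum p I X) \<epsilon> R \<theta>"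
  shows "uniform_opial (lp_sum p I X)"
proof -
  let ?S = "lp_sum p I X"
  show ?thesis
    unfolding uniform_opial_def
  proof (intro allI impI)
    fix c :: real
    assume c: "0 < c"
    obtain \<theta> where \<theta>: "0 < \<theta>" and gap2: "opial_gap ?S c 2 \<theta>"
      using gap[OF c, of 2] by auto
    \<comment> \<open>The cap at \<open>1\<close> ensures \<open>1 + r \<le> 2\<close>.\<close>
    define r where "r = min 1 \<theta>"
    have "ereal (1 + r) \<le> liminf (\<lambda>n. ereal \<parallel>xs n \<ominus>\<^bsub>?S\<^esub> x\<parallel>\<^bsub>?S\<^esub>)"
      if x: "x \<in> carrier ?S" "c \<le> \<parallel>x\<parallel>\<^bsub>?S\<^esub>" and xs: "weakly_null ?S xs"
        and one: "1 \<le> liminf (\<lambda>n. ereal \<parallel>xs n\<parallel>\<^bsub>?S\<^esub>)" for x xs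
    proof (rule ccontr)
      define L where "L = liminf (\<lambda>n. ereal \<parallel>xs n \<ominus>\<^bsub>?S\<^esub> x\<parallel>\<^bsub>?S\<^esub>)"
      assume "\<not> ereal (1 + r) \<le> liminf (\<lambda>n. ereal \<parallel>xs n \<ominus>\<^bsub>?S\<^esub> x\<parallel>\<^bsub>?S\<^esub>)"
      then have L: "L < ereal (1 + r)" by (simp add: L_def)
      have car: "xs n \<in> carrier ?S" for n using xs by (auto simp: weakly_null_def)
      have D_nonneg: "0 \<le> \<parallel>xs n \<ominus>\<^bsub>?S\<^esub> x\<parallel>\<^bsub>?S\<^esub>" for n
        by (simp add: lp_sum_simps)
      then have "0 \<le> L"
        unfolding L_def by (intro Liminf_bounded) simp
      with L obtain b where b: "L = ereal b" "b < 1 + r" by (cases L) auto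
      obtain s where s: "strict_mono s"
        and lim: "((\<lambda>n. ereal \<parallel>xs n \<ominus>\<^bsub>?S\<^esub> x\<parallel>\<^bsub>?S\<^esub>) \<circ> s) \<longlonglongrightarrow> L"
        using liminf_subseq_lim unfolding L_def by blast
      then have Ds: "(\<lambda>n. \<parallel>xs (s n) \<ominus>\<^bsub>?S\<^esub> x\<parallel>\<^bsub>?S\<^esub>) \<longlonglongrightarrow> b"
        by (simp add: b o_def)
      then obtain B where B: "\<And>n. \<parallel>xs (s n) \<ominus>\<^bsub>?S\<^esub> x\<parallel>\<^bsub>?S\<^esub> \<le> B"
        using convergent_imp_Bseq[OF convergentI[OF Ds]] by (fastforce simp: Bseq_def abs_le_iff)
      have "\<parallel>xs n\<parallel>\<^bsub>?S\<^esub> \<le> \<parallel>xs n \<ominus>\<^bsub>?S\<^esub> x\<parallel>\<^bsub>?S\<^esub> + \<parallel>x\<parallel>\<^bsub>?S\<^esub>" for n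
        using lp_sum_norm_le_minus[OF car x(1) subset_refl]
        by (simp add: vnorm_lp_sum_minus[OF subset_refl x(1)]) (simp add: lp_sum_simps)
      then have "\<parallel>xs (s n)\<parallel>\<^bsub>?S\<^esub> \<le> B + \<parallel>x\<parallel>\<^bsub>?S\<^esub>" for n
        using B[of n] by (meson add_right_mono order_trans)
      then have "range (\<lambda>n. \<parallel>xs (s n)\<parallel>\<^bsub>?S\<^esub>) \<subseteq> {0..B + \<parallel>x\<parallel>\<^bsub>?S\<^esub>}"
        by (auto simp: lp_sum_simps)
      then have "bounded (range (\<lambda>n. \<parallel>xs (s n)\<parallel>\<^bsub>?S\<^esub>))"
        by (rule bounded_subset[OF bounded_closed_interval])
      then obtain a t where t: "strict_mono t" and "((\<lambda>n. \<parallel>xs (s n)\<parallel>\<^bsub>?S\<^esub>) \<circ> t) \<longlonglongrightarrow> a"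
        using bounded_imp_convergent_subsequence by blast
      then have N: "(\<lambda>n. \<parallel>(xs \<circ> (s \<circ> t)) n\<parallel>\<^bsub>?S\<^esub>) \<longlonglongrightarrow> a" by (simp add: o_def)
      have D: "(\<lambda>n. \<parallel>(xs \<circ> (s \<circ> t)) n \<ominus>\<^bsub>?S\<^esub> x\<parallel>\<^bsub>?S\<^esub>) \<longlonglongrightarrow> b"
        using LIMSEQ_subseq_LIMSEQ[OF Ds t] by (simp add: o_def)
      have st: "strict_mono (s \<circ> t)" using s t by (rule strict_mono_o)
      have null: "weakly_null ?S (xs \<circ> (s \<circ> t))" by (rule weakly_null_subseq[OF xs st])
      have "liminf (\<lambda>n. ereal \<parallel>xs n\<parallel>\<^bsub>?S\<^esub>) \<le> liminf ((\<lambda>n. ereal \<parallel>xs n\<parallel>\<^bsub>?S\<^esub>) \<circ> (s \<circ> t))"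
        by (rule liminf_subseq_mono[OF st])
      also have "\<dots> = ereal a"
        using N by (intro lim_imp_Liminf) (auto simp: o_def)
      finally have a: "1 \<le> a" using order_trans[OF one] by fastforce
      \<comment> \<open>The size of this gap depends on \<open>a\<close>; only its sign is used.\<close>
      obtain \<theta>' where "0 < \<theta>'" "opial_gap ?S c a \<theta>'" using gap[OF c, of a] a by auto
      then have "a < b" using opial_gapD[OF _ x null N order_refl D] by fastforce
      then have "a \<le> 2" using b(2) by (simp add: r_def)
      then have "a + \<theta> \<le> b" by (rule opial_gapD[OF gap2 x null N _ D])
      then show False using a b(2) by (simp add: r_def)
    qed
    moreover have "0 < r" using \<theta> by (simp add: r_def)
    ultimately show "\<exists>r>0. \<forall>x\<in>carrier ?S. \<forall>xs. c \<le> \<parallel>x\<parallel>\<^bsub>?S\<^esub> \<longrightarrow> weakly_null ?S xs \<longrightarrow>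
        1 \<le> liminf (\<lambda>n. ereal \<parallel>xs n\<parallel>\<^bsub>?S\<^esub>) \<longrightarrow>
        ereal (1 + r) \<le> liminf (\<lambda>n. ereal \<parallel>xs n \<ominus>\<^bsub>?S\<^esub> x\<parallel>\<^bsub>?S\<^esub>)"
      by blast
  qed
qed

end

theorem theorem3p13:
  fixes p :: real and I :: "'i set" and X :: "'i \<Rightarrow> 'a normed_module"
  assumes "1 \<le> p"
    and "infinite I"
    and "\<And>i. i \<in> I \<Longrightarrow> banach_space (X i)"
    and "\<And>\<epsilon> R :: real. \<epsilon> > 0 \<Longrightarrow> R > 0 \<Longrightarrow>
      (INF J \<in> {J. J \<subseteq> I \<and> finite J}. opial_modulus (lp_sum p J X) \<epsilon> R) > 0"
  shows "uniform_opial (lp_sum p I X)"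
proof -
  interpret normed_family p I X
    using assms(1) banach_space.axioms(1)[OF assms(3)] by (rule normed_family.intro)
  show ?thesis
  proof (rule uniform_opial_lp_sumI)
    fix \<epsilon> R :: real
    assume pos: "0 < \<epsilon>" "0 < R"
    then have "0 < \<epsilon> / 2" by simp
    from ereal_dense2[OF assms(4)[OF this pos(2)]]
    obtain e where e: "0 < ereal e"
      "ereal e < (INF J \<in> {J. J \<subseteq> I \<and> finite J}. opial_modulus (lp_sum p J X) (\<epsilon> / 2) R)"
      by blast
    have "0 < e" using e(1) by simp
    then show "\<exists>\<theta>>0. opial_gap (lp_sum p I X) \<epsilon> R \<theta>"
    proof (rule lp_sum_opial_gap[OF pos])
      fix J
      assume "J \<subseteq> I" "finite J"
      then show "opial_gap (lp_sum p J X) (\<epsilon> / 2) R e"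
        using less_INF_D[OF e(2), of J] by (intro opial_gap_modulus) simp
    qed
  qed
qed

end
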